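(* For integers $2\leq t\leq k-1$, \begin{equation*} k+t-2+\binom{k+t-2}{t-1}\leq N^{\top}(k,t)\leq n(k,t-1). \end{equation*}
   Context: A family is a family of finite sets; its blocks are its members and its points are the elements of the blocks; the point set $P_{\mathcal{F}}$ is the union of all blocks, and for a finite family, $\#(P_{\mathcal{F}})$ denotes its number of points. A family is uniform if all blocks have the same size $k$. A blocking set of $\mathcal{F}$ is a set meeting every block; a transversal is a blocking set of smallest possible size, this common size being denoted $t=\tau(\mathcal{F})$ (the transversal number), and $\mathcal{F}^{\top}$ denotes the family of all transversals of $\mathcal{F}$. Define $N^{\top}(k,t)=\max\{\#(P_{\mathcal{F}^{\top}}) : \mathcal{F}$ is a uniform family with block size $k$ and transversal number $t\}$ (the maximum number of points of the family of transversals), which is finite. An intersecting set pair system $ISP(k,t)$ is a collection $\{(A_i,B_i):1\leq i\leq n\}$ of pairs of finite sets with $\#(A_i)=k$, $\#(B_i)=t$ for all $i$, and $A_i\cap B_j=\emptyset$ if and only if $i=j$; its point set is $\bigcup_i (A_i\sqcup B_i)$. Define $n(k,t)$ as the maximum number of points of an $ISP(k,t)$. *)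

theory Defs
  imports Complex_Main "HOL-Library.Extended_Nat" "HOL-Library.Infinite_Typeclass"
begin

definition points :: "'a set set \<Rightarrow> 'a set" where
  "points F = \<Union>F"

definition uniform_family :: "nat \<Rightarrow> 'a set set \<Rightarrow> bool" where
  "uniform_family k F \<longleftrightarrow> (\<forall>A\<in>F. finite A \<and> card A = k)"

definition blocking_set :: "'a set set \<Rightarrow> 'a set \<Rightarrow> bool" where
  "blocking_set F S \<longleftrightarrow> (\<forall>A\<in>F. S \<inter> A \<noteq> {})"

text \<open>The transversal number is infinite for a family without finite blocking sets; families
  may be infinite.\<close>

definition transversal_number :: "'a set set \<Rightarrow> enat" where
  "transversal_number F = (INF S\<in>{S. finite S \<and> blocking_set F S}. enat (card S))"

definition transversals :: "'a set set \<Rightarrow> 'a set set" where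
  "transversals F =
     {S. finite S \<and> blocking_set F S \<and> enat (card S) = transversal_number F}"

text \<open>The first argument of the two maxima below is the type providing the points. For an
  infinite type the values do not depend on it.\<close>

definition max_transversal_points :: "'a itself \<Rightarrow> nat \<Rightarrow> nat \<Rightarrow> nat" where
  "max_transversal_points _ k t =
     Max {card (points (transversals F)) | F :: 'a set set.
            uniform_family k F \<and> transversal_number F = enat t}"

definition intersecting_set_pairs ::
    "nat \<Rightarrow> nat \<Rightarrow> nat \<Rightarrow> (nat \<Rightarrow> 'a set) \<Rightarrow> (nat \<Rightarrow> 'a set) \<Rightarrow> bool" where
  "intersecting_set_pairs k t n A B \<longleftrightarrow>
     (\<forall>i\<in>{1..n}. finite (A i) \<and> card (A i) = k \<and> finite (B i) \<and> card (B i) = t) \<and>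
     (\<forall>i\<in>{1..n}. \<forall>j\<in>{1..n}. A i \<inter> B j = {} \<longleftrightarrow> i = j)"

definition max_set_pair_points :: "'a itself \<Rightarrow> nat \<Rightarrow> nat \<Rightarrow> nat" where
  "max_set_pair_points _ k t =
     Max {card (\<Union>i\<in>{1..n}. A i \<union> B i) | n (A :: nat \<Rightarrow> 'a set) B.
            intersecting_set_pairs k t n A B}"

end

theory Submission imports Defs begin

text \<open>Lower bound: let \<open>X\<close> have \<open>k + t - 2\<close> points, attach a private new point \<open>p T\<close> to every
  \<open>(t - 1)\<close>-subset \<open>T\<close> of \<open>X\<close>, and take the blocks \<open>(X - T) \<union> {p T}\<close>. Each \<open>T \<union> {p T}\<close> is a
  blocking set of size \<open>t\<close>, and these sets cover all points. A smaller blocking set cannot exist: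
  replacing each of its new points \<open>p T\<close> by some point of \<open>X - T\<close> and enlarging the result to a
  \<open>(t - 1)\<close>-subset \<open>U\<close> of \<open>X\<close> shows that it misses the block belonging to \<open>U\<close>.

  Upper bound: a family of \<open>k\<close>-sets with transversal number \<open>t\<close> has a finite subfamily \<open>G\<close> that
  is minimal among those without blocking sets of size less than \<open>t\<close>. Removing a block \<open>A\<close>
  from \<open>G\<close> creates a blocking set \<open>B\<close> of size \<open>t - 1\<close>, necessarily disjoint from \<open>A\<close>, and these
  pairs \<open>(A, B)\<close> form an intersecting set pair system. Every point of a transversal lies in a
  block of \<open>G\<close>.\<close>

section \<open>Transversal numbers and reduction to finite subfamilies\<close>

lemma transversal_number_eq_enat_iff:
  "transversal_number F = enat t \<longleftrightarrow>
     (\<exists>S. finite S \<and> blocking_set F S \<and> card S = t) \<and>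
     (\<forall>S. finite S \<longrightarrow> blocking_set F S \<longrightarrow> t \<le> card S)"
proof
  let ?C = "{S. finite S \<and> blocking_set F S}"
  let ?N = "(\<lambda>S. enat (card S)) ` ?C"
  assume eq: "transversal_number F = enat t"
  then have Inf_eq: "Inf ?N = enat t" by (simp add: transversal_number_def)
  \<comment> \<open>The infimum over no sets would be infinite. A nonempty set of extended naturals
    attains its infimum, which turns a finite value into a blocking set of size
    \<open>t\<close>.\<close>
  have "?N \<noteq> {}"
  proof
    assume "?N = {}"
    then have "enat t = Inf {}" using Inf_eq by metis
    then show False by (simp add: top_enat_def)
  qed
  then have "Inf ?N \<in> ?N"
    unfolding Inf_enat_def by (metis (mono_tags, lifting) LeastI all_not_in_conv)
  then have "\<exists>S. finite S \<and> blocking_set F S \<and> card S = t"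
    unfolding Inf_eq by auto
  moreover have "t \<le> card S" if "finite S" "blocking_set F S" for S
  proof -
    have "Inf ?N \<le> enat (card S)" using that by (intro Inf_lower) auto
    then show ?thesis using Inf_eq by simp
  qed
  ultimately show "(\<exists>S. finite S \<and> blocking_set F S \<and> card S = t) \<and>
     (\<forall>S. finite S \<longrightarrow> blocking_set F S \<longrightarrow> t \<le> card S)" by blast
next
  assume *: "(\<exists>S. finite S \<and> blocking_set F S \<and> card S = t) \<and>
     (\<forall>S. finite S \<longrightarrow> blocking_set F S \<longrightarrow> t \<le> card S)"
  then obtain S where S: "finite S" "blocking_set F S" "card S = t" by blast
  show "transversal_number F = enat t"
    unfolding transversal_number_def
  proof (rule antisym)
    show "(INF S\<in>{S. finite S \<and> blocking_set F S}. enat (card S)) \<le> enat t"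
      using S by (intro INF_lower2[of S]) auto
    show "enat t \<le> (INF S\<in>{S. finite S \<and> blocking_set F S}. enat (card S))"
      using * by (intro INF_greatest) auto
  qed
qed

text \<open>A compactness argument by induction on \<open>s\<close>: a blocking set contains some
  point \<open>x\<close> of a fixed block \<open>A\<close>, and its other points must block all
  blocks avoiding \<open>x\<close>, where the bound drops by one. As \<open>A\<close> is finite, the
  finite subfamilies obtained for its points, together with \<open>A\<close>, suffice.\<close>

lemma finite_subfamily_no_small_blocking_set:
  assumes "\<forall>A\<in>F. finite A"
    and "\<forall>S. finite S \<longrightarrow> blocking_set F S \<longrightarrow> s < card S"
  shows "\<exists>G\<subseteq>F. finite G \<and> (\<forall>S. finite S \<longrightarrow> blocking_set G S \<longrightarrow> s < card S)"
  using assms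
proof (induction s arbitrary: F)
  case 0
  then have "\<not> blocking_set F {}" using card.empty finite.emptyI less_irrefl by metis
  then obtain A where "A \<in> F" by (auto simp: blocking_set_def)
  then show ?case
    by (intro exI[of _ "{A}"]) (auto simp: blocking_set_def card_gt_0_iff)
next
  case (Suc s)
  then have "\<not> blocking_set F {}" using card.empty finite.emptyI not_less_zero by metis
  then obtain A where A: "A \<in> F" by (auto simp: blocking_set_def)
  have "\<exists>G\<subseteq>{B\<in>F. x \<notin> B}. finite G \<and> (\<forall>S. finite S \<longrightarrow> blocking_set G S \<longrightarrow> s < card S)" for x
  proof (rule Suc.IH)
    show "\<forall>B\<in>{B\<in>F. x \<notin> B}. finite B" using Suc.prems(1) by blast
    show "\<forall>S. finite S \<longrightarrow> blocking_set {B\<in>F. x \<notin> B} S \<longrightarrow> s < card S"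
    proof (intro allI impI)
      fix S assume S: "finite S" "blocking_set {B\<in>F. x \<notin> B} S"
      then have "blocking_set F (insert x S)" by (auto simp: blocking_set_def)
      then have "Suc s < card (insert x S)" using Suc.prems(2) S(1) by simp
      then show "s < card S" using S(1) by (auto simp: card_insert_if split: if_splits)
    qed
  qed
  then obtain G where G: "\<And>x. G x \<subseteq> {B\<in>F. x \<notin> B}" "\<And>x. finite (G x)"
    "\<And>x S. finite S \<Longrightarrow> blocking_set (G x) S \<Longrightarrow> s < card S"
    by metis
  have "Suc s < card S" if S: "finite S" "blocking_set (insert A (\<Union>x\<in>A. G x)) S" for S
  proof -
    obtain x where x: "x \<in> S" "x \<in> A" using S(2) by (auto simp: blocking_set_def)
    have "blocking_set (G x) (S - {x})"
      unfolding blocking_set_def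
    proof
      fix B assume B: "B \<in> G x"
      then have "S \<inter> B \<noteq> {}" using S(2) x(2) by (auto simp: blocking_set_def)
      moreover have "x \<notin> B" using B G(1) by blast
      ultimately show "(S - {x}) \<inter> B \<noteq> {}" by blast
    qed
    then have "s < card (S - {x})" using G(3) S(1) by blast
    then show ?thesis using S(1) x(1) by simp
  qed
  moreover have "insert A (\<Union>x\<in>A. G x) \<subseteq> F" using A G(1) by blast
  moreover have "finite (insert A (\<Union>x\<in>A. G x))" using A Suc.prems(1) G(2) by blast
  ultimately show ?case by (intro exI[of _ "insert A (\<Union>x\<in>A. G x)"]) blast
qed

section \<open>Finiteness for set pair systems\<close>

text \<open>A crude bound that serves only to make the maximum over all systems well defined. Every
  \<open>B i\<close> with \<open>i\<close> other than \<open>a\<close> meets \<open>A a\<close>, so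
  the indices split into at most \<open>k\<close> classes according to a point \<open>x\<close> of
  \<open>A a\<close>. Sizes are bounded rather than fixed so that \<open>x\<close> can be deleted
  from the sets \<open>B i\<close> of a class.\<close>

lemma card_set_pair_index_le:
  assumes "finite I"
    and "\<forall>i\<in>I. finite (A i) \<and> card (A i) \<le> k \<and> finite (B i) \<and> card (B i) \<le> t"
    and "\<forall>i\<in>I. \<forall>j\<in>I. A i \<inter> B j = {} \<longleftrightarrow> i = j"
  shows "card I \<le> (k + 1) ^ t"
  using assms
proof (induction t arbitrary: I B)
  case 0
  then have "i = j" if "i \<in> I" "j \<in> I" for i j using that by fastforce
  then have "card I \<le> 1"
    by (metis is_singletonI' is_singleton_altdef card.empty le_refl zero_le)
  then show ?case by simp
next
  case (Suc t)
  show ?case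
  proof (cases "I = {}")
    case False
    then obtain a where a: "a \<in> I" by blast
    let ?J = "\<lambda>x. {i\<in>I. x \<in> B i}"
    have J: "card (?J x) \<le> (k + 1) ^ t" for x
    proof (rule Suc.IH[where B = "\<lambda>i. B i - {x}"])
      show "finite (?J x)" using Suc.prems(1) by simp
      show "\<forall>i\<in>?J x. finite (A i) \<and> card (A i) \<le> k \<and>
          finite (B i - {x}) \<and> card (B i - {x}) \<le> t"
        using Suc.prems(2) by fastforce
      \<comment> \<open>Since \<open>A i\<close> is disjoint from \<open>B i\<close>, which contains
        \<open>x\<close>, deleting \<open>x\<close> changes no intersection within the
        class.\<close>
      have "x \<notin> A i" if "i \<in> ?J x" for i using that Suc.prems(3) by blast
      then show "\<forall>i\<in>?J x. \<forall>j\<in>?J x. (A i \<inter> (B j - {x}) = {}) = (i = j)"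
        using Suc.prems(3) by blast
    qed
    have "I \<subseteq> insert a (\<Union>x\<in>A a. ?J x)"
    proof
      fix i assume "i \<in> I"
      moreover from this have "A a \<inter> B i \<noteq> {} \<or> i = a" using Suc.prems(3) a by metis
      ultimately show "i \<in> insert a (\<Union>x\<in>A a. ?J x)" by blast
    qed
    then have "card I \<le> card (insert a (\<Union>x\<in>A a. ?J x))"
      using Suc.prems(1,2) a by (intro card_mono) auto
    also have "\<dots> \<le> Suc (card (\<Union>x\<in>A a. ?J x))" by (rule card_insert_le_m1) auto
    also have "card (\<Union>x\<in>A a. ?J x) \<le> (\<Sum>x\<in>A a. card (?J x))"
      using Suc.prems(2) a by (intro card_UN_le) auto
    also have "\<dots> \<le> card (A a) * (k + 1) ^ t"
      using sum_bounded_above[of "A a" "\<lambda>x. card (?J x)"] J by simp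
    also have "\<dots> \<le> k * (k + 1) ^ t" using Suc.prems(2) a by simp
    finally have "card I \<le> Suc (k * (k + 1) ^ t)" by simp
    moreover have "1 \<le> (k + 1) ^ t" by simp
    ultimately have "card I \<le> (k + 1) ^ t + k * (k + 1) ^ t" by linarith
    then show ?thesis by simp
  qed simp
qed

lemma finite_set_pair_point_counts:
  "finite {card (\<Union>i\<in>{1..n}. A i \<union> B i) | n (A :: nat \<Rightarrow> 'a set) B.
     intersecting_set_pairs k t n A B}"
proof (rule finite_subset[of _ "{..(k + 1) ^ t * (k + t)}"])
  have "card (\<Union>i\<in>{1..n}. A i \<union> B i) \<le> (k + 1) ^ t * (k + t)"
    if *: "intersecting_set_pairs k t n A B" for n and A B :: "nat \<Rightarrow> 'a set"
  proof -
    have "card {1..n} \<le> (k + 1) ^ t"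
      using * by (intro card_set_pair_index_le[of _ A k B]) (auto simp: intersecting_set_pairs_def)
    moreover have "card (A i \<union> B i) \<le> k + t" if "i \<in> {1..n}" for i
      using * that card_Un_le[of "A i" "B i"] by (auto simp: intersecting_set_pairs_def)
    then have "(\<Sum>i\<in>{1..n}. card (A i \<union> B i)) \<le> card {1..n} * (k + t)"
      using sum_bounded_above[of "{1..n}" "\<lambda>i. card (A i \<union> B i)" "k + t"] by simp
    moreover have "card (\<Union>i\<in>{1..n}. A i \<union> B i) \<le> (\<Sum>i\<in>{1..n}. card (A i \<union> B i))"
      by (intro card_UN_le) auto
    ultimately show ?thesis by (meson le_trans mult_le_mono1)
  qed
  then show "{card (\<Union>i\<in>{1..n}. A i \<union> B i) | n (A :: nat \<Rightarrow> 'a set) B.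
     intersecting_set_pairs k t n A B} \<subseteq> {..(k + 1) ^ t * (k + t)}" by auto
qed simp

section \<open>Upper bound by a minimal subfamily\<close>

lemma card_points_transversals_le:
  fixes F :: "'a set set"
  assumes "1 \<le> k" "1 \<le> t" and unif: "uniform_family k F"
    and tau: "transversal_number F = enat t"
  shows "card (points (transversals F)) \<le> max_set_pair_points TYPE('a) k (t - 1)"
proof -
  define large where
    "large G \<longleftrightarrow> (\<forall>S. finite S \<longrightarrow> blocking_set G S \<longrightarrow> t - 1 < card S)" for G :: "'a set set"
  have "large F"
    using tau \<open>1 \<le> t\<close> by (fastforce simp: transversal_number_eq_enat_iff large_def)
  then obtain G0 where "G0 \<subseteq> F \<and> finite G0 \<and> large G0"
    using finite_subfamily_no_small_blocking_set[of F "t - 1"] unif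
    unfolding uniform_family_def large_def by blast
  \<comment> \<open>Least cardinality implies that no block can be removed from
    \<open>G\<close>.\<close>
  then obtain G where G: "G \<subseteq> F" "finite G" "large G"
    and G_min: "\<And>H. H \<subseteq> F \<and> finite H \<and> large H \<Longrightarrow> card G \<le> card H"
    using ex_has_least_nat[of "\<lambda>H. H \<subseteq> F \<and> finite H \<and> large H" G0 card] by blast
  have block: "finite A \<and> card A = k" if "A \<in> G" for A
    using that G(1) unif by (auto simp: uniform_family_def)
  have "\<exists>S. finite S \<and> blocking_set (G - {A}) S \<and> card S = t - 1" if A: "A \<in> G" for A
  proof -
    have "card (G - {A}) < card G" using A G(2) by (rule card_Diff1_less[rotated])
    then have "\<not> large (G - {A})" using G_min[of "G - {A}"] G(1,2) by auto
    then obtain S where S: "finite S" "blocking_set (G - {A}) S" "card S \<le> t - 1"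
      by (auto simp: large_def)
    \<comment> \<open>One point of \<open>A\<close> extends \<open>S\<close> to a blocking set of
      \<open>G\<close>, so \<open>S\<close> cannot have fewer than \<open>t - 1\<close>
      points.\<close>
    obtain a where "a \<in> A" using block[OF A] \<open>1 \<le> k\<close> by fastforce
    then have "blocking_set G (insert a S)" using S(2) by (auto simp: blocking_set_def)
    then have "t - 1 < card (insert a S)" using G(3) S(1) by (simp add: large_def)
    then have "card S = t - 1" using S(1,3) by (auto simp: card_insert_if split: if_splits)
    then show ?thesis using S by blast
  qed
  then obtain B where B: "\<And>A. A \<in> G \<Longrightarrow> finite (B A)"
    "\<And>A. A \<in> G \<Longrightarrow> blocking_set (G - {A}) (B A)"
    "\<And>A. A \<in> G \<Longrightarrow> card (B A) = t - 1"
    by metis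
  have B_iff: "A \<inter> B A' = {} \<longleftrightarrow> A = A'" if "A \<in> G" "A' \<in> G" for A A'
  proof (cases "A = A'")
    case True
    \<comment> \<open>With only \<open>t - 1\<close> points, \<open>B A\<close> misses a block of
      \<open>G\<close>, and \<open>A\<close> is the only candidate.\<close>
    have "\<not> blocking_set G (B A)" using B(1,3)[OF that(1)] G(3) by (auto simp: large_def)
    then show ?thesis using B(2)[OF that(1)] True by (auto simp: blocking_set_def)
  next
    case False
    then show ?thesis using B(2)[OF that(2)] that(1) by (auto simp: blocking_set_def)
  qed
  obtain f where f: "bij_betw f {1..card G} G" using ex_bij_betw_nat_finite_1[OF G(2)] by blast
  have f_in: "f i \<in> G" if "i \<in> {1..card G}" for i using f that by (auto simp: bij_betw_def)
  have f_eq: "f i = f j \<longleftrightarrow> i = j" if "i \<in> {1..card G}" "j \<in> {1..card G}" for i j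
    using f that by (meson bij_betw_imp_inj_on inj_on_eq_iff)
  have isp: "intersecting_set_pairs k (t - 1) (card G) f (\<lambda>i. B (f i))"
    unfolding intersecting_set_pairs_def
  proof (intro conjI ballI)
    fix i j assume "i \<in> {1..card G}" "j \<in> {1..card G}"
    then show "f i \<inter> B (f j) = {} \<longleftrightarrow> i = j" using B_iff f_in f_eq by metis
  qed (use f_in block B in blast)+
  have "points (transversals F) \<subseteq> \<Union>G"
  proof
    fix x assume "x \<in> points (transversals F)"
    then obtain S where S: "x \<in> S" "finite S" "blocking_set F S" "card S = t"
      using tau by (auto simp: points_def transversals_def)
    \<comment> \<open>Some block of \<open>G\<close> is met by \<open>S\<close> but not by the
      \<open>t - 1\<close> points other than \<open>x\<close>, so it contains
      \<open>x\<close>.\<close>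
    then have "\<not> blocking_set G (S - {x})" using G(3) by (auto simp: large_def)
    then obtain A where A: "A \<in> G" "(S - {x}) \<inter> A = {}" by (auto simp: blocking_set_def)
    moreover have "S \<inter> A \<noteq> {}" using A(1) G(1) S(3) by (auto simp: blocking_set_def)
    ultimately show "x \<in> \<Union>G" by blast
  qed
  also have "\<Union>G \<subseteq> (\<Union>i\<in>{1..card G}. f i \<union> B (f i))"
    using f unfolding bij_betw_def by blast
  finally have "card (points (transversals F)) \<le> card (\<Union>i\<in>{1..card G}. f i \<union> B (f i))"
    using f_in block B(1) by (intro card_mono) auto
  also have "\<dots> \<le> max_set_pair_points TYPE('a) k (t - 1)"
    unfolding max_set_pair_points_def
    by (rule Max_ge[OF finite_set_pair_point_counts], rule CollectI,
        rule exI[of _ "card G"], rule exI[of _ f], rule exI[of _ "\<lambda>i. B (f i)"]) (use isp in simp)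
  finally show ?thesis .
qed

section \<open>Lower bound construction\<close>

lemma ex_card_points_transversals:
  assumes "2 \<le> k" "2 \<le> t"
  shows "\<exists>F :: 'a::infinite set set. uniform_family k F \<and> transversal_number F = enat t \<and>
    k + t - 2 + ((k + t - 2) choose (t - 1)) \<le> card (points (transversals F))"
proof -
  let ?n = "k + t - 2"
  obtain X :: "'a set" where X: "finite X" "card X = ?n"
    using infinite_arbitrarily_large[OF infinite_UNIV, of ?n] by blast
  have t_le: "t - 1 \<le> card X" using X(2) assms by simp
  define \<T> where "\<T> = {T. T \<subseteq> X \<and> card T = t - 1}"
  have \<T>: "finite \<T>" "card \<T> = ?n choose (t - 1)"
    using X n_subsets[of X "t - 1"] by (auto simp: \<T>_def)
  have "infinite (- X)" using X(1) by (simp add: Compl_eq_Diff_UNIV infinite_UNIV)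
  then obtain Z where Z: "finite Z" "card Z = card \<T>" "Z \<subseteq> - X"
    using infinite_arbitrarily_large[of "- X" "card \<T>"] by blast
  then obtain p where p: "bij_betw p \<T> Z"
    using finite_same_card_bij[OF \<T>(1) Z(1)] by metis
  have p_notin: "p T \<notin> X" if "T \<in> \<T>" for T using p Z(3) that by (auto simp: bij_betw_def)
  have p_eq: "T = U" if "p T = p U" "T \<in> \<T>" "U \<in> \<T>" for T U
    using p that by (auto simp: bij_betw_def inj_on_def)
  have T_props: "finite T" "T \<subseteq> X" "card T = t - 1" if "T \<in> \<T>" for T
    using that X(1) by (auto simp: \<T>_def intro: finite_subset)
  define F where "F = (\<lambda>T. insert (p T) (X - T)) ` \<T>"
  have "uniform_family k F"
    unfolding uniform_family_def F_def
    using X p_notin T_props assms by (auto simp: card_Diff_subset)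
  moreover
  have block_T: "blocking_set F (insert (p T) T)" if T: "T \<in> \<T>" for T
    unfolding blocking_set_def F_def
  proof safe
    fix U assume U: "U \<in> \<T>" and disj: "insert (p T) T \<inter> insert (p U) (X - U) = {}"
    \<comment> \<open>Inclusion between sets of equal size is equality, but then \<open>p T\<close>
      is a common point.\<close>
    then have "T \<subseteq> U" using T_props[OF T] by blast
    then have "T = U" using T_props[OF T] T_props[OF U] by (simp add: card_subset_eq)
    then show False using disj by blast
  qed
  have card_T: "card (insert (p T) T) = t" if "T \<in> \<T>" for T
    using T_props[OF that] p_notin[OF that] assms by (subst card_insert_disjoint) auto
  have tau_ge: "t \<le> card S" if S: "finite S" "blocking_set F S" for S
  proof (rule ccontr)
    assume "\<not> t \<le> card S"
    then have card_S: "card S \<le> t - 1" by simp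
    have "\<exists>x. x \<in> X - T" if "T \<in> \<T>" for T
    proof (rule ccontr)
      assume "\<nexists>x. x \<in> X - T"
      then have "X = T" using T_props[OF that] by blast
      then show False using X(2) T_props[OF that] assms by simp
    qed
    then obtain q where q: "\<And>T. T \<in> \<T> \<Longrightarrow> q T \<in> X - T" by metis
    \<comment> \<open>\<open>g\<close> fixes \<open>X\<close> and sends each private point
      \<open>p T\<close> to a point of \<open>X - T\<close>. Its values outside
      \<open>X \<union> Z\<close> are arbitrary, hence the intersection with \<open>X\<close>
      below.\<close>
    define g where "g y = (if y \<in> X then y else q (the_inv_into \<T> p y))" for y
    have g_p: "g (p T) = q T" if "T \<in> \<T>" for T
      using p p_notin[OF that] that by (simp add: g_def bij_betw_def the_inv_into_f_f)
    have "card (g ` S \<inter> X) \<le> t - 1"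
      using S(1) card_S card_image_le[of S g] card_mono[of "g ` S" "g ` S \<inter> X"] by force
    then obtain U where U: "g ` S \<inter> X \<subseteq> U" "U \<subseteq> X" "card U = t - 1"
      using exists_subset_between[OF _ t_le Int_lower2 X(1)] by metis
    then have "U \<in> \<T>" by (simp add: \<T>_def)
    then have "S \<inter> insert (p U) (X - U) \<noteq> {}" using S(2) by (auto simp: blocking_set_def F_def)
    then consider "p U \<in> S" | y where "y \<in> S" "y \<in> X - U" by blast
    then show False
    proof cases
      case 1
      then have "q U \<in> g ` S" using g_p[OF \<open>U \<in> \<T>\<close>] by (metis imageI)
      then show False using U(1) q[OF \<open>U \<in> \<T>\<close>] by blast
    next
      case 2
      then have "y \<in> g ` S \<inter> X" by (force simp: g_def)
      then show False using U(1) 2 by blast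
    qed
  qed
  have cover: "\<exists>T\<in>\<T>. x \<in> T" if "x \<in> X" for x
  proof -
    \<comment> \<open>Here \<open>2 \<le> t\<close> provides room for \<open>x\<close> in a set of
      size \<open>t - 1\<close>.\<close>
    have "card {x} \<le> t - 1" "{x} \<subseteq> X" using assms that by simp_all
    then obtain T where "{x} \<subseteq> T" "T \<subseteq> X" "card T = t - 1"
      using exists_subset_between[OF _ t_le _ X(1)] by metis
    then show ?thesis by (auto simp: \<T>_def)
  qed
  have "card \<T> > 0" using \<T>(2) assms by simp
  then obtain T0 where T0: "T0 \<in> \<T>" by (metis all_not_in_conv card_gt_0_iff)
  then have "finite (insert (p T0) T0)" using T_props by simp
  then have tau: "transversal_number F = enat t"
    unfolding transversal_number_eq_enat_iff
    using block_T[OF T0] card_T[OF T0] tau_ge by blast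
  moreover have "?n + (?n choose (t - 1)) \<le> card (points (transversals F))"
  proof -
    have trans: "insert (p T) T \<in> transversals F" if "T \<in> \<T>" for T
      using that block_T card_T tau T_props by (simp add: transversals_def)
    have "X \<union> Z \<subseteq> points (transversals F)"
    proof
      fix x assume "x \<in> X \<union> Z"
      then have "\<exists>T\<in>\<T>. x \<in> insert (p T) T"
        using cover p unfolding bij_betw_def by blast
      then show "x \<in> points (transversals F)" using trans unfolding points_def by blast
    qed
    \<comment> \<open>This inclusion guards against an infinite point set, whose \<open>card\<close>
      would be 0. Deleting a point from a transversal leaves some block unmet, so that point lies in
      a block.\<close>
    moreover have "points (transversals F) \<subseteq> X \<union> Z"
    proof
      fix x assume "x \<in> points (transversals F)"
      then obtain S where S: "x \<in> S" "finite S" "blocking_set F S" "card S = t"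
        using tau by (auto simp: points_def transversals_def)
      then have "card (S - {x}) < t" using assms by simp
      then have "\<not> blocking_set F (S - {x})" using tau_ge S(2) by (metis finite_Diff not_le)
      then obtain A where "A \<in> F" "x \<in> A" using S(3) unfolding blocking_set_def by blast
      then show "x \<in> X \<union> Z" using p by (auto simp: F_def bij_betw_def)
    qed
    ultimately have "card (points (transversals F)) = card (X \<union> Z)" by (metis subset_antisym)
    also have "\<dots> = card X + card Z" using X(1) Z by (intro card_Un_disjoint) auto
    finally show ?thesis using X(2) Z(2) \<T>(2) by simp
  qed
  ultimately show ?thesis by blast
qed

theorem theorem2p4:
  fixes k t :: nat
  assumes "2 \<le> t" and "t \<le> k - 1"
  shows "k + t - 2 + ((k + t - 2) choose (t - 1)) \<le> max_transversal_points TYPE('a::infinite) k t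
    \<and> max_transversal_points TYPE('a) k t \<le> max_set_pair_points TYPE('a) k (t - 1)"
proof -
  let ?N = "{card (points (transversals F)) | F :: 'a set set.
            uniform_family k F \<and> transversal_number F = enat t}"
  obtain F :: "'a set set" where F: "uniform_family k F" "transversal_number F = enat t"
    "k + t - 2 + ((k + t - 2) choose (t - 1)) \<le> card (points (transversals F))"
    using ex_card_points_transversals[of k t] assms by force
  have "1 \<le> k" "1 \<le> t" using assms by simp_all
  then have le: "m \<le> max_set_pair_points TYPE('a) k (t - 1)" if "m \<in> ?N" for m
    using that card_points_transversals_le by blast
  \<comment> \<open>The uniform upper bound also yields the finiteness that \<open>Max\<close>
    requires.\<close>
  then have fin: "finite ?N" by (meson finite_nat_set_iff_bounded_le)
  have F_in: "card (points (transversals F)) \<in> ?N" using F by blast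
  have "card (points (transversals F)) \<le> Max ?N" using fin F_in by (rule Max_ge)
  moreover have "Max ?N \<le> max_set_pair_points TYPE('a) k (t - 1)"
    using fin F_in le by (intro Max.boundedI) auto
  ultimately show ?thesis using F(3) by (simp add: max_transversal_points_def)
qed

end
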